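(* Let $G$ be a primitive permutation group of degree $n$ (i.e. acting on a finite set $\Omega$ of size $n$) and of permutation rank $3$. Then $G$ synchronizes every map $f:\Omega\to\Omega$ that is not a permutation and whose rank is at least $n-\left(1+\frac{\sqrt{n-1}}{12}\right)$.
   Context: A permutation group $G$ on $\Omega$ is primitive if it is transitive and preserves no equivalence relation on $\Omega$ other than equality and the universal relation. The permutation rank of a transitive group $G$ on $\Omega$ is the number of orbits of $G$ on $\Omega\times\Omega$. The rank of a map is the size of its image. $G$ synchronizes $f$ if the transformation semigroup $\langle G,f\rangle$ contains a constant map. *)

theory Defs
  imports Complex_Main "HOL-Algebra.Algebra"
begin

text \<open>
  Self-maps of \<open>\<Omega>\<close> are represented throughout by extensional functions, i.e. elements of
  \<open>\<Omega> \<rightarrow>\<^sub>E \<Omega>\<close>, composed with \<^const>\<open>compose\<close>.  A permutation group on \<open>\<Omega>\<close> is a subgroup of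
  \<^term>\<open>BijGroup \<Omega>\<close>, the symmetric group of \<open>\<Omega>\<close>.
\<close>

definition permutation_group :: "'a set \<Rightarrow> ('a \<Rightarrow> 'a) set \<Rightarrow> bool" where
  "permutation_group \<Omega> G \<longleftrightarrow> subgroup G (BijGroup \<Omega>)"

abbreviation perm_grp :: "'a set \<Rightarrow> ('a \<Rightarrow> 'a) set \<Rightarrow> ('a \<Rightarrow> 'a) monoid" where
  "perm_grp \<Omega> G \<equiv> (BijGroup \<Omega>)\<lparr>carrier := G\<rparr>"

definition transitive_perm_group :: "'a set \<Rightarrow> ('a \<Rightarrow> 'a) set \<Rightarrow> bool" where
  "transitive_perm_group \<Omega> G \<longleftrightarrow>
     permutation_group \<Omega> G \<and> transitive_action (perm_grp \<Omega> G) \<Omega> (\<lambda>g. g)"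

definition preserves_relation :: "('a \<Rightarrow> 'a) set \<Rightarrow> ('a \<times> 'a) set \<Rightarrow> bool" where
  "preserves_relation G r \<longleftrightarrow> (\<forall>g\<in>G. \<forall>(x, y)\<in>r. (g x, g y) \<in> r)"

definition primitive_perm_group :: "'a set \<Rightarrow> ('a \<Rightarrow> 'a) set \<Rightarrow> bool" where
  "primitive_perm_group \<Omega> G \<longleftrightarrow>
     transitive_perm_group \<Omega> G \<and>
     (\<forall>r. equiv \<Omega> r \<and> preserves_relation G r \<longrightarrow> r = Id_on \<Omega> \<or> r = \<Omega> \<times> \<Omega>)"

text \<open>
  The diagonal action on pairs; the restriction makes every value an element of
  \<^term>\<open>Bij (\<Omega> \<times> \<Omega>)\<close>, as the locale \<^locale>\<open>group_action\<close> requires.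
\<close>

definition pair_action :: "'a set \<Rightarrow> ('a \<Rightarrow> 'a) \<Rightarrow> 'a \<times> 'a \<Rightarrow> 'a \<times> 'a" where
  "pair_action \<Omega> g = restrict (map_prod g g) (\<Omega> \<times> \<Omega>)"

definition permutation_rank :: "'a set \<Rightarrow> ('a \<Rightarrow> 'a) set \<Rightarrow> nat" where
  "permutation_rank \<Omega> G = card (orbits (perm_grp \<Omega> G) (\<Omega> \<times> \<Omega>) (pair_action \<Omega>))"

definition map_rank :: "'a set \<Rightarrow> ('a \<Rightarrow> 'a) \<Rightarrow> nat" where
  "map_rank \<Omega> f = card (f ` \<Omega>)"

inductive_set transformation_semigroup :: "'a set \<Rightarrow> ('a \<Rightarrow> 'a) set \<Rightarrow> ('a \<Rightarrow> 'a) set"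
  for \<Omega> :: "'a set" and S :: "('a \<Rightarrow> 'a) set" where
    generator: "h \<in> S \<Longrightarrow> h \<in> transformation_semigroup \<Omega> S"
  | composition: "h \<in> transformation_semigroup \<Omega> S \<Longrightarrow> k \<in> transformation_semigroup \<Omega> S
      \<Longrightarrow> compose \<Omega> h k \<in> transformation_semigroup \<Omega> S"

definition synchronizes :: "'a set \<Rightarrow> ('a \<Rightarrow> 'a) set \<Rightarrow> ('a \<Rightarrow> 'a) \<Rightarrow> bool" where
  "synchronizes \<Omega> G f \<longleftrightarrow>
     (\<exists>h \<in> transformation_semigroup \<Omega> (insert f G). \<exists>c\<in>\<Omega>. \<forall>x\<in>\<Omega>. h x = c)"

end

theory Submission
  imports Defs
begin

text \<open>
  Suppose that \<open>G\<close> does not synchronize \<open>f\<close>. Join two points by an edge when no element of the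
  semigroup generated by \<open>G\<close> and \<open>f\<close> maps them to the same point. Precomposing with a generator
  shows that \<open>f\<close> and all elements of \<open>G\<close> are endomorphisms of this graph
  (\<open>uncollapsed_pairs_invariant\<close>). It has an edge, since otherwise an element of the semigroup of
  least rank would be constant (\<open>constant_map_if_all_collapsed\<close>), and it is not complete, since
  \<open>f\<close> identifies two points.

  The edges and the nonedges are then two nonempty \<open>G\<close>-invariant relations off the diagonal, so
  permutation rank three makes each of them a single orbit of \<open>G\<close>: the graph is strongly regular,
  with valency \<open>k\<close> and with \<open>lam\<close> (\<open>mu\<close>) common neighbours for adjacent (distinct nonadjacent)
  points. By primitivity, neither adjacency nor nonadjacency becomes an equivalence relation
  when the diagonal is added, and therefore both the graph and its complement have diameter two
  (\<open>path_of_length_two\<close>).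

  Everything hinges on the number \<open>k - mu\<close> of neighbours of a vertex that are not neighbours of a
  given vertex nonadjacent to it. It is bounded on both sides.

  From above (\<open>endomorphism_rank_le\<close>): if \<open>f x = f y\<close> with \<open>x \<noteq> y\<close>, then the \<open>2 * k - mu\<close> points
  that are adjacent to \<open>x\<close> or \<open>y\<close> all go into the \<open>k\<close> neighbours of \<open>f x\<close>. This costs \<open>k - mu\<close>
  in rank, and the collapse of \<open>x\<close> with \<open>y\<close>, which are not among these points, costs one more.

  From below (\<open>card_le_square_private_neighbours\<close>): \<open>k - mu\<close> is at least \<open>sqrt (n - 1) / 4\<close>. Two
  adjacent vertices have a common nonneighbour, so the triangle inequality for differences of
  neighbourhoods gives \<open>k - lam \<le> 2 * (k - mu)\<close>; by the standard double count, the average of these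
  differences is large, and the valencies of the graph and of its complement are at least
  \<open>sqrt (n - 1)\<close> by diameter two.

  Together they bound the rank of \<open>f\<close> by \<open>n - 1 - sqrt (n - 1) / 4\<close>, less than the assumed lower
  bound.
\<close>

section \<open>Graphs of diameter two\<close>

text \<open>
  This is the edge relation of the complementary graph, hence without the diagonal.
\<close>

abbreviation nonadjacency :: "'a set \<Rightarrow> ('a \<times> 'a) set \<Rightarrow> ('a \<times> 'a) set" where
  "nonadjacency V E \<equiv> V \<times> V - Id - E"

text \<open>
  The inequality of Moore for diameter two: the ball of radius two around \<open>x\<close> is the whole graph.
  Each of the \<open>k\<close> neighbours \<open>z\<close> of \<open>x\<close> accounts for itself and its neighbours other than \<open>x\<close>,
  which are \<open>k\<close> points in all.
\<close>

lemma card_le_square_valency: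
  assumes "finite V" "E \<subseteq> V \<times> V" "sym E" "x \<in> V"
    and valency: "\<And>y. y \<in> V \<Longrightarrow> card (E `` {y}) = k"
    and diam: "\<And>y. (x, y) \<in> nonadjacency V E \<Longrightarrow> \<exists>z. (x, z) \<in> E \<and> (z, y) \<in> E"
  shows "card V \<le> k * k + 1"
proof -
  let ?N = "\<lambda>y. E `` {y}"
  have fin: "finite (?N y)" for y
    by (rule finite_subset[OF _ assms(1)]) (use assms(2) in auto)
  have block: "card (insert z (?N z - {x})) \<le> k" if "z \<in> ?N x" for z
  proof -
    have z: "z \<in> V" "x \<in> ?N z"
      using that assms(2,3) by (auto dest: symD)
    have "card (insert z (?N z - {x})) \<le> Suc (card (?N z - {x}))"
      by (rule card_insert_le_m1) (use fin in auto)
    also have "\<dots> = card (?N z)"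
      using fin z(2) by (rule card.remove[symmetric])
    finally show ?thesis using valency z(1) by simp
  qed
  have "V - {x} \<subseteq> (\<Union>z\<in>?N x. insert z (?N z - {x}))"
  proof
    fix y assume y: "y \<in> V - {x}"
    show "y \<in> (\<Union>z\<in>?N x. insert z (?N z - {x}))"
    proof (cases "(x, y) \<in> E")
      case False
      then obtain z where "(x, z) \<in> E" "(z, y) \<in> E"
        using diam[of y] y assms(4) by auto
      then show ?thesis using y by auto
    qed auto
  qed
  then have "card (V - {x}) \<le> card (\<Union>z\<in>?N x. insert z (?N z - {x}))"
    by (rule card_mono[rotated]) (use fin in auto)
  also have "\<dots> \<le> (\<Sum>z\<in>?N x. card (insert z (?N z - {x})))"
    by (rule card_UN_le) (rule fin)
  also have "\<dots> \<le> (\<Sum>z\<in>?N x. k)"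
    by (rule sum_mono) (rule block)
  also have "\<dots> = k * k"
    using valency assms(4) by simp
  finally show ?thesis
    using assms(1,4) by (simp add: card_Diff_singleton)
qed

section \<open>Strongly regular graphs\<close>

locale strongly_regular_graph =
  fixes V :: "'a set" and E :: "('a \<times> 'a) set" and k lam mu :: nat
  assumes finite_V: "finite V"
    and E_subset: "E \<subseteq> V \<times> V"
    and sym_E: "sym E"
    and irrefl_E: "irrefl E"
    and valency: "x \<in> V \<Longrightarrow> card (E `` {x}) = k"
    and common_adjacent: "(x, y) \<in> E \<Longrightarrow> card (E `` {x} \<inter> E `` {y}) = lam"
    and common_nonadjacent:
      "(x, y) \<in> nonadjacency V E \<Longrightarrow> card (E `` {x} \<inter> E `` {y}) = mu"
begin

lemma finite_neighbours: "finite (E `` {x})"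
  by (rule finite_subset[OF _ finite_V]) (use E_subset in auto)

lemma neighbours_nonadjacency:
  assumes "x \<in> V"
  shows "nonadjacency V E `` {x} = V - {x} - E `` {x}"
  using assms by auto

lemma card_nonneighbours:
  assumes "x \<in> V"
  shows "card (nonadjacency V E `` {x}) = card V - 1 - k" "k \<le> card V - 1"
proof -
  have sub: "E `` {x} \<subseteq> V - {x}"
    using E_subset irrefl_E by (auto simp: irrefl_def)
  show "card (nonadjacency V E `` {x}) = card V - 1 - k"
    using assms sub finite_neighbours finite_V valency
    by (simp add: neighbours_nonadjacency card_Diff_subset card_Diff_singleton)
  show "k \<le> card V - 1"
    using card_mono[OF _ sub] finite_V valency[OF assms] assms by simp
qed

text \<open>
  Both sides count the walks of length two from \<open>x\<close>: on the left by the middle vertex, on the right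
  by whether the end is \<open>x\<close>, a neighbour or a nonneighbour of \<open>x\<close>.
\<close>

lemma parameter_equation:
  assumes "x \<in> V"
  shows "k * k = k + k * lam + (card V - 1 - k) * mu"
proof -
  let ?N = "\<lambda>y. E `` {y}" and ?C = "nonadjacency V E `` {x}"
  have V: "V = insert x (?N x \<union> ?C)"
    using assms E_subset by auto
  have x: "x \<notin> ?N x \<union> ?C"
    using irrefl_E by (auto simp: irrefl_def)
  have finC: "finite ?C"
    using finite_V by (simp add: neighbours_nonadjacency[OF assms])
  have "k * k = (\<Sum>y\<in>V. card {z \<in> ?N x. (z, y) \<in> E})"
  proof (subst sum_multicount[where k = k and T = "?N x"])
    show "\<forall>z\<in>?N x. card {y \<in> V. (z, y) \<in> E} = k"
    proof
      fix z assume "z \<in> ?N x"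
      then have "{y \<in> V. (z, y) \<in> E} = ?N z" "z \<in> V"
        using E_subset by auto
      then show "card {y \<in> V. (z, y) \<in> E} = k"
        using valency by simp
    qed
  qed (use finite_V finite_neighbours valency assms in auto)
  also have "\<dots> = (\<Sum>y\<in>V. card (?N x \<inter> ?N y))"
    by (intro sum.cong refl arg_cong[where f = card]) (use sym_E in \<open>auto dest: symD\<close>)
  also have "\<dots> = card (?N x) + ((\<Sum>y\<in>?N x. card (?N x \<inter> ?N y))
      + (\<Sum>y\<in>?C. card (?N x \<inter> ?N y)))"
    by (subst V, subst sum.insert, use finite_neighbours finC x in simp, use x in simp,
        subst sum.union_disjoint) (use finite_neighbours finC in auto)
  also have "(\<Sum>y\<in>?N x. card (?N x \<inter> ?N y)) = (\<Sum>y\<in>?N x. lam)"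
    by (rule sum.cong) (auto simp: common_adjacent)
  also have "(\<Sum>y\<in>?C. card (?N x \<inter> ?N y)) = (\<Sum>y\<in>?C. mu)"
    by (rule sum.cong) (auto simp: common_nonadjacent)
  finally show ?thesis
    using valency[OF assms] card_nonneighbours(1)[OF assms] by simp
qed

text \<open>
  The distance between two vertices used below is the number of neighbours that one has and the
  other lacks. It is symmetric, because the graph is regular, and equal to \<open>k - lam\<close> or \<open>k - mu\<close>.
\<close>

lemma private_neighbours:
  assumes "x \<in> V"
  shows "card (E `` {x} - E `` {y}) = k - card (E `` {x} \<inter> E `` {y})"
    "card (E `` {x} \<inter> E `` {y}) \<le> k"
proof -
  show "card (E `` {x} - E `` {y}) = k - card (E `` {x} \<inter> E `` {y})"
    using finite_neighbours valency[OF assms] by (simp add: card_Diff_subset_Int)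
  show "card (E `` {x} \<inter> E `` {y}) \<le> k"
    using finite_neighbours valency[OF assms] by (metis card_mono inf_le1)
qed

text \<open>
  The triangle inequality for this distance, along a path of two nonedges.
\<close>

lemma private_neighbours_triangle:
  assumes "(x, y) \<in> E" "(x, w) \<in> nonadjacency V E" "(w, y) \<in> nonadjacency V E"
  shows "k - lam \<le> 2 * (k - mu)"
proof -
  have "k - lam = card (E `` {x} - E `` {y})"
    using assms E_subset private_neighbours common_adjacent by auto
  also have "\<dots> \<le> card ((E `` {x} - E `` {w}) \<union> (E `` {w} - E `` {y}))"
    by (rule card_mono) (use finite_neighbours in auto)
  also have "\<dots> \<le> card (E `` {x} - E `` {w}) + card (E `` {w} - E `` {y})"
    by (rule card_Un_le)
  also have "\<dots> = 2 * (k - mu)"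
    using assms private_neighbours common_nonadjacent by auto
  finally show ?thesis .
qed

text \<open>
  Put \<open>c = n - 1 - k\<close>, the valency of the complement. In terms of the two distances \<open>a = k - mu\<close>
  and \<open>b = k - lam\<close>, the parameter equation says \<open>k * b + c * a = k * (c + 1)\<close>: the distances from a
  fixed vertex have a prescribed sum. Since \<open>b \<le> 2 * a\<close>, this forces
  \<open>k * c \<le> 2 * (k + c) * a\<close>. The larger of \<open>k\<close> and \<open>c\<close> is at least half of \<open>k + c = n - 1\<close>, so the
  smaller one is at most \<open>4 * a\<close>, while its square is at least \<open>n - 1\<close>.
\<close>

theorem card_le_square_private_neighbours:
  assumes diam: "\<And>x y. (x, y) \<in> nonadjacency V E \<Longrightarrow> \<exists>z. (x, z) \<in> E \<and> (z, y) \<in> E"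
    and codiam: "\<And>x y. (x, y) \<in> E \<Longrightarrow>
      \<exists>z. (x, z) \<in> nonadjacency V E \<and> (z, y) \<in> nonadjacency V E"
  shows "card V \<le> 16 * (k - mu)\<^sup>2 + 1"
proof (cases "card V \<le> 1")
  case False
  then obtain u v where "u \<in> V" "v \<in> V" "u \<noteq> v"
    using card_le_Suc0_iff_eq[OF finite_V] by auto
  then obtain x y where xy: "(x, y) \<in> E"
    using diam[of u v] by auto
  then obtain w where w: "(x, w) \<in> nonadjacency V E" "(w, y) \<in> nonadjacency V E"
    using codiam by blast
  have x: "x \<in> V" and y: "y \<in> V" using xy E_subset by auto
  define c where "c = card V - 1 - k"
  have cV: "card V = k + c + 1"
    using card_nonneighbours(2)[OF x] False unfolding c_def by simp
  have k_sq: "k + c \<le> k * k"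
    using card_le_square_valency[OF finite_V E_subset sym_E x valency diam] cV by simp
  have "card V \<le> c * c + 1"
  proof (rule card_le_square_valency[OF finite_V _ _ x])
    show "nonadjacency V E \<subseteq> V \<times> V" by auto
    show "sym (nonadjacency V E)" using sym_E by (auto simp: sym_def)
    show "card (nonadjacency V E `` {z}) = c" if "z \<in> V" for z
      using card_nonneighbours(1)[OF that] by (simp add: c_def)
    show "\<exists>u. (x, u) \<in> nonadjacency V E \<and> (u, z) \<in> nonadjacency V E"
      if "(x, z) \<in> nonadjacency V (nonadjacency V E)" for z
      using that by (intro codiam) auto
  qed
  then have c_sq: "k + c \<le> c * c" using cV by simp
  define a b where "a = k - mu" and "b = k - lam"
  have "mu \<le> k"
    using private_neighbours(2)[OF x, of w] common_nonadjacent[OF w(1)] by simp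
  then have k_mu: "k = a + mu" by (simp add: a_def)
  have "lam \<le> k"
    using private_neighbours(2)[OF x, of y] common_adjacent[OF xy] by simp
  then have k_lam: "k = b + lam" by (simp add: b_def)
  have "k * k = k + k * lam + c * mu"
    using parameter_equation[OF x] by (simp add: c_def)
  moreover have "k * k = k * b + k * lam" "k * c = c * a + c * mu"
    using k_lam k_mu by (metis distrib_left mult.commute)+
  ultimately have "k * b + c * a = k + k * c" by linarith
  moreover have "k * b \<le> k * (2 * a)"
    using private_neighbours_triangle[OF xy w] by (simp add: a_def b_def)
  ultimately have "k * c \<le> k * (2 * a) + c * a" by linarith
  also have "\<dots> = (2 * k + c) * a" by (simp add: algebra_simps)
  also have "\<dots> \<le> 2 * (k + c) * a" by (intro mult_right_mono) auto
  finally have main: "k * c \<le> 2 * (k + c) * a" .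
  \<comment> \<open>The situation is symmetric in the graph and its complement; \<open>p\<close> is the smaller valency.\<close>
  have bound: "p + q \<le> 16 * a\<^sup>2"
    if "p \<le> q" "p + q \<le> p * p" "p * q \<le> 2 * (p + q) * a" for p q :: nat
  proof (cases "q = 0")
    case False
    have "p * q \<le> 2 * (p + q) * a" by (fact that)
    also have "\<dots> \<le> 2 * (q + q) * a" using that(1) by (intro mult_right_mono) auto
    finally have "q * p \<le> q * (4 * a)" by (simp add: algebra_simps)
    then have "p \<le> 4 * a" using False by (metis mult_le_cancel1 neq0_conv)
    then have "p * p \<le> (4 * a) * (4 * a)" by (metis mult_le_mono)
    with that(2) show ?thesis by (simp add: power2_eq_square)
  qed (use that in simp)
  have "k + c \<le> 16 * a\<^sup>2"
  proof (cases "k \<le> c")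
    case True
    then show ?thesis using bound[OF _ k_sq main] by simp
  next
    case False
    then show ?thesis using bound[of c k] c_sq main by (simp add: ac_simps)
  qed
  then show ?thesis using cV by (simp add: a_def)
qed simp

text \<open>
  The points adjacent to \<open>x\<close> or \<open>y\<close> lose at least \<open>k - mu\<close> under \<open>f\<close>, as they all go to neighbours
  of \<open>f x\<close>. Neither \<open>x\<close> nor \<open>y\<close> is such a point, so one more point is lost by deleting \<open>x\<close>,
  which leaves the image of \<open>f\<close> unchanged.
\<close>

lemma endomorphism_rank_le:
  assumes f: "f \<in> V \<rightarrow> V"
    and endo: "\<And>x y. (x, y) \<in> E \<Longrightarrow> (f x, f y) \<in> E"
    and xy: "x \<in> V" "y \<in> V" "x \<noteq> y" "f x = f y"
  shows "card (f ` V) + 1 + (k - mu) \<le> card V"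
proof -
  let ?A = "E `` {x} \<union> E `` {y}"
  have nonadj: "(x, y) \<in> nonadjacency V E"
    using xy endo[of x y] irrefl_E by (auto simp: irrefl_def)
  have A: "?A \<subseteq> V - {x}"
    using E_subset irrefl_E sym_E nonadj by (auto simp: irrefl_def dest: symD)
  have finA: "finite ?A" using finite_neighbours by auto
  have "card ?A + mu = 2 * k"
    using card_Un_Int[OF finite_neighbours finite_neighbours, of x y]
      valency xy common_nonadjacent[OF nonadj] by simp
  moreover have "mu \<le> k"
    using private_neighbours(2)[OF xy(1), of y] common_nonadjacent[OF nonadj] by simp
  ultimately have cardA: "card ?A = k + (k - mu)" by simp
  have "f ` ?A \<subseteq> E `` {f x}"
    using endo xy(4) by force
  then have "card (f ` ?A) \<le> k"
    using card_mono[OF finite_neighbours] valency[of "f x"] f xy(1) by fastforce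
  moreover have "card (f ` (V - {x} - ?A)) \<le> card (V - {x} - ?A)"
    by (rule card_image_le) (use finite_V in simp)
  moreover have "card (V - {x} - ?A) + card ?A + 1 = card V"
  proof -
    have "card (V - {x} - ?A) + card ?A = card (V - {x})"
      using card_Diff_subset[OF finA A] card_mono[OF _ A] finite_V by simp
    moreover have "card (V - {x}) + 1 = card V"
      using card.remove[OF finite_V xy(1)] by simp
    ultimately show ?thesis by linarith
  qed
  moreover have "card (f ` V) \<le> card (f ` ?A) + card (f ` (V - {x} - ?A))"
  proof -
    have "V = insert x (V - {x})" using xy(1) by blast
    then have "f ` V = insert (f x) (f ` (V - {x}))" by (metis image_insert)
    also have "\<dots> = f ` (V - {x})"
      using xy by (intro insert_absorb) (simp add: image_iff, blast)
    also have "V - {x} = ?A \<union> (V - {x} - ?A)" using A by blast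
    finally have "f ` V = f ` ?A \<union> f ` (V - {x} - ?A)" by (simp only: image_Un)
    then show ?thesis by (metis card_Un_le)
  qed
  ultimately show ?thesis using cardA by linarith
qed

end

section \<open>Primitive groups of permutation rank three\<close>

locale rank_three_group =
  fixes V :: "'a set" and G :: "('a \<Rightarrow> 'a) set"
  assumes finite_V: "finite V"
    and primitive: "primitive_perm_group V G"
    and rank: "permutation_rank V G = 3"
begin

lemma transitive: "transitive_perm_group V G"
  using primitive by (simp add: primitive_perm_group_def)

lemma subgroup_G: "subgroup G (BijGroup V)"
  using transitive by (simp add: transitive_perm_group_def permutation_group_def)

lemma G_bij: "g \<in> G \<Longrightarrow> bij_betw g V V"
  using subgroup.subset[OF subgroup_G] by (auto simp: BijGroup_def Bij_def)

lemma G_closed: "g \<in> G \<Longrightarrow> x \<in> V \<Longrightarrow> g x \<in> V"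
  by (rule bij_betw_apply[OF G_bij])

lemma G_inj: "g \<in> G \<Longrightarrow> x \<in> V \<Longrightarrow> y \<in> V \<Longrightarrow> g x = g y \<longleftrightarrow> x = y"
  by (rule inj_on_eq_iff[OF bij_betw_imp_inj_on[OF G_bij]])

lemma identity_in_G: "(\<lambda>x\<in>V. x) \<in> G"
  using subgroup.one_closed[OF subgroup_G] by (simp add: BijGroup_def)

lemma G_inverse:
  assumes "g \<in> G"
  obtains g' where "g' \<in> G" "\<And>x. x \<in> V \<Longrightarrow> g' (g x) = x"
proof
  have g: "g \<in> Bij V"
    using assms subgroup.subset[OF subgroup_G] by (auto simp: BijGroup_def)
  show "restrict (inv_into V g) V \<in> G"
    using subgroup.m_inv_closed[OF subgroup_G assms] inv_BijGroup[OF g] by simp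
  show "restrict (inv_into V g) V (g x) = x" if "x \<in> V" for x
    using that G_closed[OF assms] G_bij[OF assms]
    by (simp add: bij_betw_imp_inj_on)
qed

lemma G_transitive:
  assumes "x \<in> V" "y \<in> V"
  obtains g where "g \<in> G" "g x = y"
proof -
  have "transitive_action (perm_grp V G) V (\<lambda>g. g)"
    using transitive by (simp only: transitive_perm_group_def)
  from transitive_action.unique_orbit[OF this assms]
  obtain g where "g \<in> carrier (perm_grp V G)" "g x = y" by blast
  then show ?thesis using that by simp
qed

abbreviation pair_orbit :: "'a \<times> 'a \<Rightarrow> ('a \<times> 'a) set" where
  "pair_orbit p \<equiv> orbit (perm_grp V G) (pair_action V) p"

lemma pair_orbit_eq:
  assumes "x \<in> V" "y \<in> V"
  shows "pair_orbit (x, y) = {(g x, g y) | g. g \<in> G}"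
  using assms by (auto simp: orbit_def pair_action_def)

lemma self_in_pair_orbit:
  assumes "p \<in> V \<times> V"
  shows "p \<in> pair_orbit p"
proof -
  obtain x y where p: "p = (x, y)" "x \<in> V" "y \<in> V" using assms by blast
  have "((\<lambda>x\<in>V. x) x, (\<lambda>x\<in>V. x) y) \<in> {(g x, g y) | g. g \<in> G}"
    using identity_in_G by blast
  then show ?thesis using p by (simp add: pair_orbit_eq)
qed

lemma invariant_nonadjacency:
  assumes "preserves_relation G R"
  shows "preserves_relation G (nonadjacency V R)"
proof -
  have "(g x, g y) \<in> nonadjacency V R"
    if g: "g \<in> G" and xy: "x \<in> V" "y \<in> V" "x \<noteq> y" "(x, y) \<notin> R" for g x y
  proof -
    obtain g' where g': "g' \<in> G" "\<And>x. x \<in> V \<Longrightarrow> g' (g x) = x"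
      using G_inverse[OF g] by blast
    have "(g x, g y) \<notin> R"
      using assms g' xy unfolding preserves_relation_def by fastforce
    then show ?thesis using G_closed G_inj g xy by simp
  qed
  then show ?thesis unfolding preserves_relation_def by blast
qed

text \<open>
  Orbits that lie in the diagonal, in \<open>R\<close> and in \<open>nonadjacency V R\<close> are distinct. As there are only
  three orbits, each of the three relations is a single one. In particular, a symmetric \<open>R\<close> of this
  kind leaves no room for an orbit that differs from its converse: the two would lie both in \<open>R\<close> or
  both in \<open>nonadjacency V R\<close>.
\<close>

lemma orbit_of_invariant_relation:
  assumes R: "R \<subseteq> V \<times> V" "irrefl R" "preserves_relation G R"
    and ne: "nonadjacency V R \<noteq> {}"
    and p: "p \<in> R" and q: "q \<in> R"
  shows "q \<in> pair_orbit p"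
proof -
  let ?C = "nonadjacency V R"
  obtain r where r: "r \<in> ?C" using ne by blast
  \<comment> \<open>a point of the diagonal; the domain is nonempty because it carries \<open>p\<close>\<close>
  define d where "d = (fst p, fst p)"
  have d: "d \<in> V \<times> V" "d \<in> Id" using p R(1) by (auto simp: d_def)
  have orbit_sub: "pair_orbit s \<subseteq> S" if "s \<in> S" "S \<subseteq> V \<times> V" "preserves_relation G S" for s S
    using that by (cases s) (auto simp: orbit_def pair_action_def preserves_relation_def)
  have Id_inv: "preserves_relation G (Id_on V)"
    using G_closed by (auto simp: preserves_relation_def)
  have subs: "pair_orbit p \<subseteq> R" "pair_orbit q \<subseteq> R" "pair_orbit r \<subseteq> ?C" "pair_orbit d \<subseteq> Id_on V"
    using orbit_sub[OF p R(1,3)] orbit_sub[OF q R(1,3)]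
      orbit_sub[OF r _ invariant_nonadjacency[OF R(3)]] orbit_sub[OF _ _ Id_inv, of d] d by auto
  have selfs: "p \<in> pair_orbit p" "q \<in> pair_orbit q" "r \<in> pair_orbit r" "d \<in> pair_orbit d"
    using self_in_pair_orbit p q r d R(1) by blast+
  have disj: "R \<inter> ?C = {}" "R \<inter> Id_on V = {}" "?C \<inter> Id_on V = {}"
    using R(2) by (auto simp: irrefl_def)
  let ?O = "orbits (perm_grp V G) (V \<times> V) (pair_action V)"
  let ?T = "{pair_orbit d, pair_orbit p, pair_orbit r}"
  have dist: "pair_orbit d \<noteq> pair_orbit p" "pair_orbit d \<noteq> pair_orbit r"
      "pair_orbit p \<noteq> pair_orbit r" "pair_orbit q \<noteq> pair_orbit d" "pair_orbit q \<noteq> pair_orbit r"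
    subgoal using subs(1,4) selfs(1) disj(2) by blast
    subgoal using subs(3,4) selfs(3) disj(3) by blast
    subgoal using subs(1,3) selfs(1) disj(1) by blast
    subgoal using subs(2,4) selfs(2) disj(2) by blast
    subgoal using subs(2,3) selfs(2) disj(1) by blast
    done
  have O: "card ?O = 3" using rank by (simp add: permutation_rank_def)
  then have "finite ?O" by (metis card.infinite zero_neq_numeral)
  moreover have in_O: "pair_orbit s \<in> ?O" if "s \<in> V \<times> V" for s
    using that unfolding orbits_def by blast
  then have "?T \<subseteq> ?O" using d p r R(1) by blast
  moreover have "card ?T = card ?O" using O dist by simp
  ultimately have "?T = ?O" by (rule card_subset_eq)
  moreover have "pair_orbit q \<in> ?O" using in_O q R(1) by blast
  ultimately have "pair_orbit q = pair_orbit p" using dist by blast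
  then show ?thesis using selfs by simp
qed

lemma transitive_on_invariant_relation:
  assumes "R \<subseteq> V \<times> V" "irrefl R" "preserves_relation G R" "nonadjacency V R \<noteq> {}"
    and "(x, y) \<in> R" "(x', y') \<in> R"
  obtains g where "g \<in> G" "g x = x'" "g y = y'"
proof -
  have "(x', y') \<in> pair_orbit (x, y)" "x \<in> V" "y \<in> V"
    using orbit_of_invariant_relation[OF assms] assms(1,5) by auto
  with that show ?thesis by (auto simp: pair_orbit_eq)
qed

text \<open>
  If no nonadjacent pair had a common neighbour, then \<open>R\<close> together with the diagonal would be
  transitive, a nontrivial \<open>G\<close>-invariant equivalence relation. So some nonadjacent pair has one, and
  \<open>G\<close> carries this pair to every other.
\<close>

lemma path_of_length_two:
  assumes R: "R \<subseteq> V \<times> V" "irrefl R" "sym R" "preserves_relation G R" "R \<noteq> {}"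
    and xy: "(x, y) \<in> nonadjacency V R"
  shows "\<exists>z. (x, z) \<in> R \<and> (z, y) \<in> R"
proof -
  let ?C = "nonadjacency V R"
  have "\<exists>u v w. (u, v) \<in> ?C \<and> (u, w) \<in> R \<and> (w, v) \<in> R"
  proof (rule ccontr)
    assume none: "\<not> ?thesis"
    let ?S = "R \<union> Id_on V"
    have "trans ?S"
    proof (rule transI)
      fix a b c assume abc: "(a, b) \<in> ?S" "(b, c) \<in> ?S"
      then have V: "a \<in> V" "c \<in> V" using R(1) by auto
      show "(a, c) \<in> ?S"
      proof (cases "a = b \<or> b = c \<or> a = c")
        case False
        then have "(a, b) \<in> R" "(b, c) \<in> R" using abc by auto
        then have "(a, c) \<notin> ?C" using none by blast
        then show ?thesis using V False by blast
      qed (use abc V in auto)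
    qed
    moreover have "sym ?S" using R(3) by (auto simp: sym_def)
    moreover have "refl_on V ?S" using R(1) by (auto simp: refl_on_def)
    ultimately have "equiv V ?S" using R(1) by (auto intro!: equivI)
    moreover have "preserves_relation G ?S"
      using R(4) G_closed by (auto simp: preserves_relation_def)
    ultimately have "?S = Id_on V \<or> ?S = V \<times> V"
      using primitive by (simp add: primitive_perm_group_def)
    moreover have "?S \<noteq> Id_on V"
    proof -
      obtain a b where "(a, b) \<in> R" using R(5) by auto
      moreover from this have "(a, b) \<notin> Id_on V" using R(2) by (auto simp: irrefl_def)
      ultimately show ?thesis by blast
    qed
    moreover have "?S \<noteq> V \<times> V"
    proof
      assume "?S = V \<times> V"
      then have "(x, y) \<in> ?S" using xy by simp
      then show False using xy by auto
    qed
    ultimately show False by blast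
  qed
  then obtain u v w where uvw: "(u, v) \<in> ?C" "(u, w) \<in> R" "(w, v) \<in> R" by blast
  have "irrefl ?C" by (auto simp: irrefl_def)
  moreover have "nonadjacency V ?C \<noteq> {}" using R(1,2,5) by (auto simp: irrefl_def)
  ultimately obtain g where "g \<in> G" "g u = x" "g v = y"
    using transitive_on_invariant_relation[of ?C] invariant_nonadjacency[OF R(4)] uvw(1) xy
    by blast
  then show ?thesis
    using uvw R(4) unfolding preserves_relation_def by blast
qed

lemma image_neighbours:
  assumes "R \<subseteq> V \<times> V" "preserves_relation G R" "g \<in> G" "x \<in> V"
  shows "g ` (R `` {x}) = R `` {g x}"
proof
  show "g ` (R `` {x}) \<subseteq> R `` {g x}"
    using assms unfolding preserves_relation_def by blast
  show "R `` {g x} \<subseteq> g ` (R `` {x})"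
  proof
    fix z assume z: "z \<in> R `` {g x}"
    then have "z \<in> g ` V" using assms(1) G_bij[OF assms(3)] by (auto simp: bij_betw_def)
    then obtain u where u: "u \<in> V" "z = g u" by blast
    obtain g' where "g' \<in> G" "\<And>x. x \<in> V \<Longrightarrow> g' (g x) = x"
      using G_inverse[OF assms(3)] by blast
    then have "(x, u) \<in> R"
      using z u assms(2,4) unfolding preserves_relation_def by fastforce
    then show "z \<in> g ` (R `` {x})" using u by blast
  qed
qed

lemma card_common_neighbours_image:
  assumes R: "R \<subseteq> V \<times> V" "preserves_relation G R" "g \<in> G" "x \<in> V" "y \<in> V"
  shows "card (R `` {g x} \<inter> R `` {g y}) = card (R `` {x} \<inter> R `` {y})"
proof -
  have inj: "inj_on g V" using G_bij R(3) by (auto simp: bij_betw_def)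
  have "g ` (R `` {x} \<inter> R `` {y}) = R `` {g x} \<inter> R `` {g y}"
  proof -
    have "R `` {x} \<subseteq> V" "R `` {y} \<subseteq> V" using R(1) by auto
    then show ?thesis
      by (simp only: inj_on_image_Int[OF inj] image_neighbours[OF R(1-3) R(4)]
          image_neighbours[OF R(1-3) R(5)])
  qed
  moreover have "inj_on g (R `` {x} \<inter> R `` {y})"
    by (rule inj_on_subset[OF inj]) (use R(1) in auto)
  ultimately show ?thesis by (metis card_image)
qed

lemma invariant_graph_strongly_regular:
  assumes R: "R \<subseteq> V \<times> V" "irrefl R" "sym R" "preserves_relation G R"
    and ne: "R \<noteq> {}" "nonadjacency V R \<noteq> {}"
  obtains k lam mu where "strongly_regular_graph V R k lam mu"
proof -
  let ?C = "nonadjacency V R"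
  obtain x y where xy: "(x, y) \<in> R" using ne by auto
  obtain u v where uv: "(u, v) \<in> ?C" using ne by auto
  have x: "x \<in> V" "y \<in> V" "u \<in> V" "v \<in> V" using xy uv R(1) by auto
  have "strongly_regular_graph V R (card (R `` {x}))
    (card (R `` {x} \<inter> R `` {y})) (card (R `` {u} \<inter> R `` {v}))"
  proof
    show "card (R `` {z}) = card (R `` {x})" if z: "z \<in> V" for z
    proof -
      obtain g where "g \<in> G" "g x = z" using G_transitive[OF x(1) z] .
      then show ?thesis
        using card_common_neighbours_image[OF R(1,4) _ x(1) x(1), of g] by simp
    qed
    show "card (R `` {z} \<inter> R `` {w}) = card (R `` {x} \<inter> R `` {y})" if zw: "(z, w) \<in> R" for z w
    proof -
      obtain g where "g \<in> G" "g x = z" "g y = w"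
        using transitive_on_invariant_relation[OF R(1,2,4) ne(2) xy zw] by blast
      then show ?thesis
        using card_common_neighbours_image[OF R(1,4) _ x(1,2), of g] by simp
    qed
    show "card (R `` {z} \<inter> R `` {w}) = card (R `` {u} \<inter> R `` {v})" if zw: "(z, w) \<in> ?C" for z w
    proof -
      have "irrefl ?C" "?C \<subseteq> V \<times> V" by (auto simp: irrefl_def)
      moreover have "nonadjacency V ?C \<noteq> {}" using R(1,2) ne by (auto simp: irrefl_def)
      ultimately obtain g where "g \<in> G" "g u = z" "g v = w"
        using transitive_on_invariant_relation[OF _ _ invariant_nonadjacency[OF R(4)] _ uv zw]
        by blast
      then show ?thesis
        using card_common_neighbours_image[OF R(1,4) _ x(3,4), of g] by simp
    qed
  qed (fact finite_V R)+
  then show ?thesis by (rule that)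
qed

text \<open>
  The complement of an invariant graph is again invariant, so that \<open>path_of_length_two\<close> applies to
  both and yields the two hypotheses of \<open>card_le_square_private_neighbours\<close>.
\<close>

theorem endomorphism_rank_bound:
  assumes R: "R \<subseteq> V \<times> V" "irrefl R" "sym R" "preserves_relation G R" "R \<noteq> {}"
    and f: "f \<in> V \<rightarrow> V"
    and endo: "\<And>x y. (x, y) \<in> R \<Longrightarrow> (f x, f y) \<in> R"
    and xy: "x \<in> V" "y \<in> V" "x \<noteq> y" "f x = f y"
  shows "real (card (f ` V)) \<le> real (card V) - 1 - sqrt (real (card V) - 1) / 4"
proof -
  let ?C = "nonadjacency V R"
  have "(x, y) \<notin> R" using endo[of x y] xy(4) R(2) by (auto simp: irrefl_def)
  then have ne: "?C \<noteq> {}" using xy by auto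
  obtain k lam mu where "strongly_regular_graph V R k lam mu"
    using invariant_graph_strongly_regular[OF R(1-4) R(5) ne] .
  then interpret strongly_regular_graph V R k lam mu .
  have C: "?C \<subseteq> V \<times> V" "irrefl ?C" "sym ?C"
    using R(3) by (auto simp: irrefl_def sym_def)
  have "card V \<le> 16 * (k - mu)\<^sup>2 + 1"
  proof (rule card_le_square_private_neighbours)
    show "\<exists>z. (u, z) \<in> R \<and> (z, v) \<in> R" if "(u, v) \<in> ?C" for u v
      using path_of_length_two[OF R that] .
    show "\<exists>z. (u, z) \<in> ?C \<and> (z, v) \<in> ?C" if "(u, v) \<in> R" for u v
      by (rule path_of_length_two[OF C invariant_nonadjacency[OF R(4)] ne])
        (use that R(1,2) in \<open>auto simp: irrefl_def\<close>)
  qed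
  then have "real (card V) \<le> real (16 * (k - mu)\<^sup>2 + 1)"
    by (rule of_nat_mono)
  then have "real (card V) - 1 \<le> (4 * real (k - mu))\<^sup>2"
    by (simp add: power_mult_distrib)
  then have "sqrt (real (card V) - 1) \<le> 4 * real (k - mu)"
    by (rule real_le_lsqrt[rotated]) auto
  moreover have "real (card (f ` V) + 1 + (k - mu)) \<le> real (card V)"
    using endomorphism_rank_le[OF f endo xy] by (rule of_nat_mono)
  ultimately show ?thesis by simp
qed

end

section \<open>The graph of uncollapsed pairs\<close>

definition uncollapsed_pairs :: "'a set \<Rightarrow> ('a \<Rightarrow> 'a) set \<Rightarrow> ('a \<times> 'a) set" where
  "uncollapsed_pairs V S =
     {(x, y) \<in> V \<times> V. \<forall>h \<in> transformation_semigroup V S. h x \<noteq> h y}"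

lemma transformation_semigroup_closed:
  assumes "h \<in> transformation_semigroup V S" "\<And>s. s \<in> S \<Longrightarrow> s \<in> V \<rightarrow> V"
  shows "h \<in> V \<rightarrow> V"
  using assms(1)
proof induction
  case (generator h)
  then show ?case by (rule assms(2))
next
  case (composition h k)
  then show ?case by (intro funcset_compose)
qed

text \<open>
  Generators are endomorphisms: a semigroup element that identified \<open>s x\<close> with \<open>s y\<close> would, composed
  with \<open>s\<close>, identify \<open>x\<close> with \<open>y\<close>.
\<close>

lemma uncollapsed_pairs_invariant:
  assumes "s \<in> S" "s \<in> V \<rightarrow> V" "(x, y) \<in> uncollapsed_pairs V S"
  shows "(s x, s y) \<in> uncollapsed_pairs V S"
proof -
  have "h (s x) \<noteq> h (s y)" if "h \<in> transformation_semigroup V S" for h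
  proof -
    have "compose V h s \<in> transformation_semigroup V S"
      using transformation_semigroup.composition[OF that transformation_semigroup.generator[OF assms(1)]] .
    then show ?thesis using assms(3) by (force simp: uncollapsed_pairs_def compose_def)
  qed
  then show ?thesis using assms(2,3) by (auto simp: uncollapsed_pairs_def)
qed

text \<open>
  An element \<open>h\<close> of least rank is constant: if it took two values, some \<open>k\<close> in the semigroup would
  identify them, and \<open>k\<close> after \<open>h\<close> would have smaller rank.
\<close>

lemma constant_map_if_all_collapsed:
  assumes "finite V" "V \<noteq> {}" "S \<noteq> {}" "\<And>s. s \<in> S \<Longrightarrow> s \<in> V \<rightarrow> V"
    and none: "uncollapsed_pairs V S = {}"
  shows "\<exists>h \<in> transformation_semigroup V S. \<exists>c\<in>V. \<forall>x\<in>V. h x = c"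
proof -
  let ?T = "transformation_semigroup V S"
  obtain s where "s \<in> ?T" using assms(3) transformation_semigroup.generator by fast
  then obtain h where h: "h \<in> ?T" and min: "\<And>h'. h' \<in> ?T \<Longrightarrow> card (h ` V) \<le> card (h' ` V)"
    using ex_has_least_nat[of "\<lambda>h. h \<in> ?T" s "\<lambda>h. card (h ` V)"] by blast
  have hV: "h \<in> V \<rightarrow> V" using transformation_semigroup_closed h assms(4) by blast
  have const: "h x = h y" if xy: "x \<in> V" "y \<in> V" for x y
  proof (rule ccontr)
    assume neq: "h x \<noteq> h y"
    have "h x \<in> V" "h y \<in> V" using hV xy by auto
    then obtain k where k: "k \<in> ?T" "k (h x) = k (h y)"
      using none by (auto simp: uncollapsed_pairs_def)
    have "\<not> inj_on k (h ` V)" using k(2) neq xy by (auto simp: inj_on_def)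
    then have "card (k ` h ` V) < card (h ` V)"
      using assms(1) by (meson card_image_le eq_card_imp_inj_on finite_imageI le_neq_implies_less)
    moreover have "k ` h ` V = compose V k h ` V" by (force simp: compose_def)
    moreover have "compose V k h \<in> ?T" using transformation_semigroup.composition[OF k(1) h] .
    ultimately show False using min by fastforce
  qed
  obtain x where "x \<in> V" using assms(2) by blast
  then show ?thesis using h hV const by blast
qed

section \<open>Synchronization\<close>

theorem theorem1p3:
  fixes \<Omega> :: "'a set" and G :: "('a \<Rightarrow> 'a) set" and n :: nat and f :: "'a \<Rightarrow> 'a"
  assumes "finite \<Omega>" and "card \<Omega> = n"
    and "primitive_perm_group \<Omega> G"
    and "permutation_rank \<Omega> G = 3"
    and "f \<in> \<Omega> \<rightarrow>\<^sub>E \<Omega>"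
    and "\<not> bij_betw f \<Omega> \<Omega>"
    and "real (map_rank \<Omega> f) \<ge> real n - (1 + sqrt (real n - 1) / 12)"
  shows "synchronizes \<Omega> G f"
proof (rule ccontr)
  assume not_sync: "\<not> synchronizes \<Omega> G f"
  interpret rank_three_group \<Omega> G
    using assms(1,3,4) by unfold_locales
  let ?S = "insert f G"
  let ?R = "uncollapsed_pairs \<Omega> ?S"
  have f: "f \<in> \<Omega> \<rightarrow> \<Omega>" using assms(5) by auto
  have S: "s \<in> \<Omega> \<rightarrow> \<Omega>" if "s \<in> ?S" for s
    using that f G_closed by auto
  have "\<not> inj_on f \<Omega>"
    using assms(1,6) f by (auto simp: bij_betw_def endo_inj_surj image_subset_iff_funcset)
  then obtain x y where xy: "x \<in> \<Omega>" "y \<in> \<Omega>" "x \<noteq> y" "f x = f y"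
    by (auto simp: inj_on_def)
  have R: "?R \<subseteq> \<Omega> \<times> \<Omega>" "irrefl ?R" "sym ?R"
    by (force simp: uncollapsed_pairs_def irrefl_def sym_def
        intro: transformation_semigroup.generator)+
  have R_inv: "preserves_relation G ?R"
    using uncollapsed_pairs_invariant[OF _ S] by (auto simp: preserves_relation_def)
  have R_ne: "?R \<noteq> {}"
  proof
    assume none: "?R = {}"
    have "\<Omega> \<noteq> {}" using xy(1) by blast
    then have "synchronizes \<Omega> G f"
      unfolding synchronizes_def
      by (rule constant_map_if_all_collapsed[OF assms(1) _ insert_not_empty S none])
    with not_sync show False by contradiction
  qed
  have endo: "(f u, f v) \<in> ?R" if "(u, v) \<in> ?R" for u v
    using uncollapsed_pairs_invariant[OF _ f that] by simp
  have "real (card (f ` \<Omega>)) \<le> real n - 1 - sqrt (real n - 1) / 4"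
    using endomorphism_rank_bound[OF R R_inv R_ne f endo xy] assms(2) by simp
  moreover have "real n - (1 + sqrt (real n - 1) / 12) \<le> real (card (f ` \<Omega>))"
    using assms(7) by (simp only: map_rank_def)
  ultimately have "sqrt (real n - 1) \<le> 0" by linarith
  then have "real n \<le> 1" by simp
  then have "card \<Omega> \<le> Suc 0" using assms(2) by simp
  then show False
    using xy card_le_Suc0_iff_eq[OF assms(1)] by blast
qed

end
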